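(* Let $\mu > 0$ and let $D \subset \mathbb{R}^3$ be a bounded domain (connected open set) whose complement $\mathbb{R}^3 \setminus D$ is connected. Let $r > 0$ be such that $|B_r| = |D|$, where $|\cdot|$ denotes Lebesgue measure (volume) and $B_r$ is an open ball of radius $r$. Define $$E_\mu^{+}(x,y) = \frac{\exp\{\mu|x-y|\}}{|x-y|}, \qquad E_\mu^{-}(x,y) = \frac{\exp\{-\mu|x-y|\}}{|x-y|}, \qquad x \neq y,$$ and $$a_3^+(t) = \Gamma\!\left(\tfrac{5}{2}\right)\frac{I_{3/2}(t)}{(t/2)^{3/2}},$$ where $I_{3/2}$ is the modified Bessel function of order $3/2$. Suppose that for some $x_0 \in D$ the identities $$a_3^+(\mu r)\, E_\mu^{+}(x, x_0) = \frac{1}{|D|}\int_D E_\mu^{+}(y, x)\, \mathrm{d}y \quad\text{and}\quad a_3^+(\mu r)\, E_\mu^{-}(x, x_0) = \frac{1}{|D|}\int_D E_\mu^{-}(y, x)\, \mathrm{d}y$$ both hold for every $x \in \mathbb{R}^3 \setminus D$. Then $D = B_r(x_0)$, the open ball of radius $r$ centred at $x_0$.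
   Context: $E_\mu^{\pm}$ are the two fundamental solutions of the modified Helmholtz (Yukawa) equation $\nabla^2 u - \mu^2 u = 0$ in $\mathbb{R}^3$. $B_r(x) = \{y \in \mathbb{R}^3 : |y-x| < r\}$. *)

theory Defs
  imports "HOL-Analysis.Analysis"
begin

text \<open>Modified Bessel function of the first kind of (real) order nu, via its power series
  (intended for t > 0).\<close>
definition bessel_I :: "real \<Rightarrow> real \<Rightarrow> real" where
  "bessel_I nu t = (\<Sum>k. (t / 2) powr (2 * real k + nu) / (fact k * Gamma (real k + nu + 1)))"

definition a3_plus :: "real \<Rightarrow> real" where
  "a3_plus t = Gamma (5 / 2) * bessel_I (3 / 2) t / (t / 2) powr (3 / 2)"

text \<open>Fundamental solutions of the modified Helmholtz equation (for x \<noteq> y).\<close>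
definition E_plus :: "real \<Rightarrow> real^3 \<Rightarrow> real^3 \<Rightarrow> real" where
  "E_plus \<mu> x y = exp (\<mu> * dist x y) / dist x y"

definition E_minus :: "real \<Rightarrow> real^3 \<Rightarrow> real^3 \<Rightarrow> real" where
  "E_minus \<mu> x y = exp (- \<mu> * dist x y) / dist x y"

end

theory Submission
  imports Defs
begin

text \<open>
  Subtracting the two identities shows that the everywhere smooth solution
  \<open>s(x) = sinh (\<mu> |x|) / |x|\<close> satisfies \<open>\<integral>\<^sub>D s(x - y) dy = c s(x - x\<^sub>0)\<close> outside \<open>D\<close>, with
  \<open>c = a\<^sub>3\<^sup>+(\<mu> r) |D|\<close>. Integrating over a spherical shell about \<open>x\<^sub>0\<close> that lies outside \<open>D\<close> and
  using the mean value property of \<open>s\<close> transports this identity to \<open>x = x\<^sub>0\<close>, so that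
  \<open>\<integral>\<^sub>D s(y - x\<^sub>0) dy = c \<mu> = \<integral>\<^sub>B s(y - x\<^sub>0) dy\<close> for the ball \<open>B\<close> of radius \<open>r\<close> about \<open>x\<^sub>0\<close>. Since
  \<open>s\<close> is radially strictly increasing and \<open>|D| = |B|\<close>, \<open>D\<close> and \<open>B\<close> agree up to a null set, and
  \<open>D \<subseteq> B\<close> because \<open>D\<close> is open. A point of \<open>B - D\<close> would contradict the identity for the decaying
  kernel, because inside \<open>B\<close> the potential of \<open>B\<close> is strictly below that of the point mass.
\<close>

section \<open>Integration of radial and shifted radial functions\<close>

text \<open>A disc of radius \<open>sqrt s\<close> has area \<open>pi * s\<close>, so the squared
  norm pushes planar Lebesgue measure forward to \<open>pi\<close> times length on the half-line.
  These are polar coordinates with the squared radius as variable, which makes the density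
  constant.\<close>

lemma nn_integral_norm_square_plane:
  fixes g :: "real \<Rightarrow> ennreal"
  assumes [measurable]: "g \<in> borel_measurable borel"
  shows "(\<integral>\<^sup>+p. g ((norm p)\<^sup>2) \<partial>(lborel :: (real \<times> real) measure))
    = (\<integral>\<^sup>+t. ennreal pi * g t * indicator {0..} t \<partial>lborel)"
proof -
  \<comment> \<open>The sign is flipped so that the rays \<open>{s<..}\<close> pull back to discs:
    comparing measures on such rays requires finite values.\<close>
  let ?n = "\<lambda>p :: real \<times> real. - (norm p)\<^sup>2"
  have M: "distr lborel borel ?n = density lborel (\<lambda>t. ennreal pi * indicator {..0} t)"
  proof (rule measure_eqI_lessThan)
    fix s :: real
    have L: "emeasure (distr lborel borel ?n) {s<..} = (if s < 0 then ennreal (pi * (- s)) else 0)"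
    proof (cases "s < 0")
      case True
      have "?n -` {s<..} = ball 0 (sqrt (- s))"
      proof -
        have "s < - (norm p)\<^sup>2 \<longleftrightarrow> norm p < sqrt (- s)" for p :: "real \<times> real"
          using real_sqrt_less_iff[of "(norm p)\<^sup>2" "- s"] by auto
        then show ?thesis by (intro set_eqI) (simp add: mem_ball_0)
      qed
      then show ?thesis
        using True by (simp add: emeasure_distr emeasure_ball unit_ball_vol_2)
    next
      case False
      then have "?n -` {s<..} = {}"
        by (auto simp: not_less) (smt (verit) zero_le_power2)
      with False show ?thesis by (simp add: emeasure_distr)
    qed
    have "emeasure (density lborel (\<lambda>t. ennreal pi * indicator {..0} t)) {s<..}
      = (\<integral>\<^sup>+t. ennreal pi * indicator {s<..0} t \<partial>lborel)"
      by (subst emeasure_density)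
         (auto intro!: nn_integral_cong split: split_indicator)
    also have "\<dots> = ennreal pi * emeasure lborel {s<..0}"
      by (simp add: nn_integral_cmult)
    also have "\<dots> = (if s < 0 then ennreal (pi * (- s)) else 0)"
      by (auto simp: ennreal_mult[symmetric])
    finally show "emeasure (distr lborel borel ?n) {s<..}
      = emeasure (density lborel (\<lambda>t. ennreal pi * indicator {..0} t)) {s<..}"
      using L by simp
    show "emeasure (distr lborel borel ?n) {s<..} < \<infinity>"
      using L by simp
  qed simp_all
  have "(\<integral>\<^sup>+p. g ((norm p)\<^sup>2) \<partial>(lborel :: (real \<times> real) measure))
      = (\<integral>\<^sup>+t. g (- t) \<partial>distr lborel borel ?n)"
    by (simp add: nn_integral_distr)
  also have "\<dots> = (\<integral>\<^sup>+t. ennreal pi * indicator {..0} t * g (- t) \<partial>lborel)"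
    unfolding M by (subst nn_integral_density) auto
  also have "\<dots> = (\<integral>\<^sup>+t. ennreal pi * indicator {..0} (- t) * g t \<partial>lborel)"
    by (subst nn_integral_real_affine[where c="-1" and t=0]) auto
  also have "\<dots> = (\<integral>\<^sup>+t. ennreal pi * g t * indicator {0..} t \<partial>lborel)"
    by (auto intro!: nn_integral_cong split: split_indicator)
  finally show ?thesis .
qed

text \<open>The preimage of a box is its image under the inverse map, which is again orthogonal and
  so preserves volume. This permits turning any unit vector into a coordinate axis.\<close>

lemma lborel_distr_orthogonal_transformation:
  fixes T :: "real^'n::{finite,wellorder} \<Rightarrow> real^'n::{finite,wellorder}"
  assumes T: "orthogonal_transformation T"
  shows "distr lborel borel T = lborel"
proof (rule lborel_eqI[symmetric])
  have [measurable]: "T \<in> borel_measurable borel"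
    using T by (intro borel_measurable_continuous_onI linear_continuous_on)
      (simp add: orthogonal_transformation_linear linear_conv_bounded_linear[symmetric])
  fix l u :: "real^'n::{finite,wellorder}"
  assume lu: "\<And>b. b \<in> Basis \<Longrightarrow> l \<bullet> b \<le> u \<bullet> b"
  have eq: "T -` box l u = inv T ` box l u"
    using orthogonal_transformation_bij[OF T] by (simp add: bij_vimage_eq_inv_image)
  have iT: "orthogonal_transformation (inv T)"
    by (rule orthogonal_transformation_inv[OF T])
  have lm: "T -` box l u \<in> lmeasurable"
    unfolding eq by (rule measurable_orthogonal_image[OF iT]) simp
  have b: "T -` box l u \<in> sets borel"
    using measurable_sets[of T borel borel "box l u"] by simp
  have "emeasure lborel (T -` box l u) = emeasure lebesgue (T -` box l u)"
    using b by simp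
  also have "\<dots> = ennreal (measure lebesgue (T -` box l u))"
    by (rule emeasure_eq_measure2[OF lm])
  also have "measure lebesgue (T -` box l u) = measure lebesgue (box l u)"
    unfolding eq by (rule measure_orthogonal_image[OF iT]) simp
  finally have *: "emeasure lborel (T -` box l u) = ennreal (\<Prod>b\<in>Basis. (u - l) \<bullet> b)"
    using lu by simp
  show "emeasure (distr lborel borel T) (box l u) = ennreal (\<Prod>b\<in>Basis. (u - l) \<bullet> b)"
    by (simp add: emeasure_distr *)
qed simp

text \<open>Boxes pull back to products of three intervals. The nested pair splits space into a
  height and a plane, so that Fubini can be combined with the planar formula.\<close>

lemma lborel_real3_distr:
  "distr lborel borel (\<lambda>(h, a, b). h *\<^sub>R axis 1 1 + a *\<^sub>R axis 2 1 + b *\<^sub>R axis 3 1)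
    = (lborel :: (real^3) measure)" (is "distr _ _ ?f = _")
proof (rule lborel_eqI[symmetric])
  have c: "continuous_on UNIV ?f"
    by (auto simp: case_prod_unfold intro!: continuous_intros)
  have [measurable]: "?f \<in> borel_measurable borel"
    by (rule borel_measurable_continuous_onI[OF c])
  fix l u :: "real^3"
  assume lu: "\<And>b. b \<in> Basis \<Longrightarrow> l \<bullet> b \<le> u \<bullet> b"
  have le: "l $ i \<le> u $ i" for i
    using lu[of "axis i 1"] by (simp add: inner_axis axis_in_Basis_iff)
  have B: "(Basis :: (real^3) set) = {axis 1 1, axis 2 1, axis 3 1}"
    by (auto simp: Basis_vec_def UNIV_3)
  have "?f -` box l u = {l$1<..<u$1} \<times> ({l$2<..<u$2} \<times> {l$3<..<u$3})"
    by (auto simp: mem_box_cart forall_3 axis_def)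
  moreover have "emeasure lborel ({l$1<..<u$1} \<times> ({l$2<..<u$2} \<times> {l$3<..<u$3}))
      = ennreal ((u$1 - l$1) * ((u$2 - l$2) * (u$3 - l$3)))"
    unfolding lborel_prod[symmetric]
    by (simp add: lborel.emeasure_pair_measure_Times le ennreal_mult
        sigma_finite_measure.emeasure_pair_measure_Times lborel_pair.sigma_finite_measure_axioms)
  moreover have "(\<Prod>b\<in>Basis. (u - l) \<bullet> b) = (u$1 - l$1) * ((u$2 - l$2) * (u$3 - l$3))"
    by (simp add: B axis_eq_axis inner_axis)
  ultimately show "emeasure (distr lborel borel ?f) (box l u) = ennreal (\<Prod>b\<in>Basis. (u - l) \<bullet> b)"
    by (simp add: emeasure_distr)
qed simp


text \<open>Archimedes' hat-box theorem: on the sphere of radius \<open>sqrt t\<close>, the height in direction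
  \<open>e\<close> is uniformly distributed.\<close>

lemma nn_integral_norm_square_height:
  fixes F :: "real \<times> real \<Rightarrow> ennreal" and e :: "real^3"
  assumes F[measurable]: "F \<in> borel_measurable borel" and e: "norm e = 1"
  shows "(\<integral>\<^sup>+x. F ((norm x)\<^sup>2, x \<bullet> e) \<partial>lborel)
    = ennreal pi * (\<integral>\<^sup>+t. (\<integral>\<^sup>+h. F (t, h) * indicator {h. h\<^sup>2 \<le> t} h \<partial>lborel) \<partial>lborel)"
proof -
  \<comment> \<open>Rotation invariance replaces \<open>e\<close> by the first axis, along which the
    height is simply a coordinate.\<close>
  obtain T :: "real^3 \<Rightarrow> real^3" where T: "orthogonal_transformation T" and Te: "T (axis 1 1) = e"
    using orthogonal_transformation_exists[of "axis 1 1 :: real^3" e] e by (metis norm_axis_1)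
  have [measurable]: "T \<in> borel_measurable borel"
    using T by (intro borel_measurable_continuous_onI linear_continuous_on)
      (simp add: orthogonal_transformation_linear linear_conv_bounded_linear[symmetric])
  have F'[measurable]: "F \<in> borel_measurable (borel \<Otimes>\<^sub>M borel)"
    using F by (simp add: borel_prod)
  \<comment> \<open>The region of integration in the (t, h)-plane; being closed, it supplies the
    joint measurability needed to exchange the two integrations.\<close>
  define S :: "(real \<times> real) set" where "S = {q. (snd q)\<^sup>2 \<le> fst q}"
  have "closed S"
    unfolding S_def by (intro closed_Collect_le continuous_intros)
  then have [measurable]: "S \<in> sets (borel \<Otimes>\<^sub>M borel)"
    unfolding borel_prod by (rule borel_closed)
  define f :: "real \<times> real \<times> real \<Rightarrow> real^3" where
    "f = (\<lambda>(h, a, b). h *\<^sub>R axis 1 1 + a *\<^sub>R axis 2 1 + b *\<^sub>R axis 3 1)"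
  have "continuous_on UNIV f"
    by (auto simp: f_def case_prod_unfold intro!: continuous_intros)
  then have [measurable]: "f \<in> borel_measurable borel"
    by (rule borel_measurable_continuous_onI)
  have nf: "(norm (f (h, p)))\<^sup>2 = h\<^sup>2 + (norm p)\<^sup>2" for h p
    unfolding power2_norm_eq_inner f_def
    by (cases p) (simp add: inner_simps inner_axis_axis norm_Pair power2_eq_square)
  have hf: "f (h, p) \<bullet> axis 1 1 = h" for h p
    by (cases p) (simp add: f_def inner_simps inner_axis_axis)
  have "(\<integral>\<^sup>+x. F ((norm x)\<^sup>2, x \<bullet> e) \<partial>lborel) = (\<integral>\<^sup>+x. F ((norm x)\<^sup>2, x \<bullet> e) \<partial>distr lborel borel T)"
    by (simp add: lborel_distr_orthogonal_transformation[OF T])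
  also have "\<dots> = (\<integral>\<^sup>+x. F ((norm (T x))\<^sup>2, T x \<bullet> T (axis 1 1)) \<partial>lborel)"
    by (subst nn_integral_distr) (auto simp: Te)
  also have "\<dots> = (\<integral>\<^sup>+x. F ((norm x)\<^sup>2, x \<bullet> axis 1 1) \<partial>(lborel :: (real^3) measure))"
    using T by (simp add: orthogonal_transformation_norm) (simp add: orthogonal_transformation_def)
  also have "\<dots> = (\<integral>\<^sup>+x. F ((norm x)\<^sup>2, x \<bullet> axis 1 1) \<partial>distr lborel borel f)"
    by (simp add: f_def lborel_real3_distr)
  also have "\<dots> = (\<integral>\<^sup>+q. F ((norm (f q))\<^sup>2, f q \<bullet> axis 1 1) \<partial>lborel)"
    by (subst nn_integral_distr) auto
  also have "\<dots> = (\<integral>\<^sup>+q. F ((fst q)\<^sup>2 + (norm (snd q))\<^sup>2, fst q) \<partial>(lborel \<Otimes>\<^sub>M (lborel :: (real \<times> real) measure)))"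
    unfolding lborel_prod by (intro nn_integral_cong) (metis nf hf prod.collapse)
  also have "\<dots> = (\<integral>\<^sup>+h. (\<integral>\<^sup>+p. F (h\<^sup>2 + (norm p)\<^sup>2, h) \<partial>(lborel :: (real \<times> real) measure)) \<partial>lborel)"
    by (subst lborel.nn_integral_fst[symmetric]) auto
  also have "\<dots> = (\<integral>\<^sup>+h. (\<integral>\<^sup>+s. ennreal pi * F (h\<^sup>2 + s, h) * indicator {0..} s \<partial>lborel) \<partial>lborel)"
    by (intro nn_integral_cong nn_integral_norm_square_plane[where g="\<lambda>s. F (_ + s, _)"]) measurable
  \<comment> \<open>At fixed height \<open>h\<close> the squared norm in space is
    \<open>t = h\<^sup>2 + s\<close>, with \<open>s\<close> the squared norm in the plane. The shift
    leaves the density constant, which is why the height is uniformly distributed once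
    \<open>t\<close> is fixed.\<close>
  also have "\<dots> = (\<integral>\<^sup>+h. (\<integral>\<^sup>+t. ennreal pi * F (t, h) * indicator {h\<^sup>2..} t \<partial>lborel) \<partial>lborel)"
  proof (rule nn_integral_cong)
    fix h :: real
    show "(\<integral>\<^sup>+s. ennreal pi * F (h\<^sup>2 + s, h) * indicator {0..} s \<partial>lborel)
      = (\<integral>\<^sup>+t. ennreal pi * F (t, h) * indicator {h\<^sup>2..} t \<partial>lborel)"
      by (subst (2) nn_integral_real_affine[where c=1 and t="h\<^sup>2"])
         (auto intro!: nn_integral_cong split: split_indicator)
  qed
  also have "\<dots> = (\<integral>\<^sup>+h. (\<integral>\<^sup>+t. ennreal pi * F (t, h) * indicator S (t, h) \<partial>lborel) \<partial>lborel)"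
    by (auto simp: S_def intro!: nn_integral_cong split: split_indicator)
  also have "\<dots> = (\<integral>\<^sup>+t. (\<integral>\<^sup>+h. ennreal pi * F (t, h) * indicator S (t, h) \<partial>lborel) \<partial>lborel)"
    by (rule lborel_pair.Fubini') measurable
  also have "\<dots> = (\<integral>\<^sup>+t. ennreal pi * (\<integral>\<^sup>+h. F (t, h) * indicator {h. h\<^sup>2 \<le> t} h \<partial>lborel) \<partial>lborel)"
    by (subst nn_integral_cmult[symmetric])
       (auto simp: S_def intro!: nn_integral_cong split: split_indicator)
  also have "\<dots> = ennreal pi * (\<integral>\<^sup>+t. (\<integral>\<^sup>+h. F (t, h) * indicator {h. h\<^sup>2 \<le> t} h \<partial>lborel) \<partial>lborel)"
  proof (rule nn_integral_cmult)
    have "(\<lambda>t. \<integral>\<^sup>+h. F (t, h) * indicator S (t, h) \<partial>lborel) \<in> borel_measurable lborel"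
      by measurable
    then show "(\<lambda>t. \<integral>\<^sup>+h. F (t, h) * indicator {h. h\<^sup>2 \<le> t} h \<partial>lborel) \<in> borel_measurable lborel"
      by (simp add: S_def indicator_def)
  qed
  finally show ?thesis .
qed

section \<open>Integrals of radial functions, and of radial weights against a kernel centred
  elsewhere\<close>

lemma Collect_square_le:
  fixes t :: real
  shows "{h. h\<^sup>2 \<le> t} = (if t \<ge> 0 then {- sqrt t..sqrt t} else {})"
proof -
  have "h\<^sup>2 \<le> t \<longleftrightarrow> \<bar>h\<bar> \<le> sqrt t" for h
    using real_sqrt_le_iff[of "h\<^sup>2" t] by simp
  moreover have "\<not> h\<^sup>2 \<le> t" if "t < 0" for h
    using that zero_le_power2[of h] by linarith
  ultimately show ?thesis by (auto simp: abs_le_iff)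
qed

lemma nn_integral_lborel_plus:
  fixes c :: "'a::euclidean_space" and G :: "'a \<Rightarrow> ennreal"
  assumes [measurable]: "G \<in> borel_measurable borel"
  shows "(\<integral>\<^sup>+x. G (c + x) \<partial>lborel) = (\<integral>\<^sup>+x. G x \<partial>lborel)"
proof -
  have "(\<integral>\<^sup>+x. G x \<partial>lborel) = (\<integral>\<^sup>+x. G x \<partial>distr lborel borel ((+) c))"
    by (simp add: lborel_distr_plus)
  also have "\<dots> = (\<integral>\<^sup>+x. G (c + x) \<partial>lborel)"
    by (subst nn_integral_distr) auto
  finally show ?thesis by simp
qed

text \<open>With no dependence on the height, the inner integral is the length
  \<open>2 * sqrt t\<close> of the interval of heights. Substituting t = rho^2 gives the familiar
  density 4 pi rho^2.\<close>

lemma nn_integral_radial: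
  fixes Q :: "real \<Rightarrow> ennreal" and p :: "real^3"
  assumes [measurable]: "Q \<in> borel_measurable borel"
  shows "(\<integral>\<^sup>+x. Q ((dist x p)\<^sup>2) \<partial>lborel)
    = ennreal pi * (\<integral>\<^sup>+t. Q t * ennreal (2 * sqrt t) * indicator {0..} t \<partial>lborel)"
proof -
  have inner: "(\<integral>\<^sup>+h. Q t * indicator {h. h\<^sup>2 \<le> t} h \<partial>lborel)
      = Q t * ennreal (2 * sqrt t) * indicator {0..} t" for t :: real
  proof (cases "t \<ge> 0")
    case True
    then show ?thesis
      unfolding Collect_square_le by (subst nn_integral_cmult_indicator) auto
  next
    case False
    then show ?thesis by (simp add: Collect_square_le)
  qed
  have "(\<integral>\<^sup>+x. Q ((dist x p)\<^sup>2) \<partial>lborel) = (\<integral>\<^sup>+x. Q ((norm x)\<^sup>2) \<partial>(lborel :: (real^3) measure))"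
    by (subst nn_integral_lborel_plus[symmetric, where c=p]) (auto simp: dist_norm)
  also have "\<dots> = ennreal pi * (\<integral>\<^sup>+t. (\<integral>\<^sup>+h. Q t * indicator {h. h\<^sup>2 \<le> t} h \<partial>lborel) \<partial>lborel)"
    using nn_integral_norm_square_height[of "\<lambda>q. Q (fst q)" "axis 1 1"]
    by (simp add: borel_prod[symmetric])
  finally show ?thesis unfolding inner .
qed

text \<open>The square root is the distance w from a point at height \<open>h\<close> on the sphere
  of radius \<open>sqrt t\<close> to the axis point at distance \<open>d\<close> from the centre.
  Since dw/dh = -d/w, the factor 1/w is exactly what makes \<open>- P w / d\<close> an
  antiderivative; the poles of the sphere give the two end values.\<close>

lemma nn_integral_height_kernel:
  fixes P k :: "real \<Rightarrow> real"
  assumes d: "d > 0" and t: "t \<ge> 0" and td: "t \<noteq> d\<^sup>2"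
    and P: "\<And>w. w > 0 \<Longrightarrow> (P has_real_derivative k w) (at w)"
    and k: "\<And>w. w > 0 \<Longrightarrow> 0 \<le> k w"
  shows "(\<integral>\<^sup>+h. ennreal (k (sqrt (t - 2 * d * h + d\<^sup>2)) / sqrt (t - 2 * d * h + d\<^sup>2))
      * indicator {h. h\<^sup>2 \<le> t} h \<partial>lborel)
    = ennreal ((P (sqrt t + d) - P \<bar>sqrt t - d\<bar>) / d)"
proof -
  define w where "w h = sqrt (t - 2 * d * h + d\<^sup>2)" for h
  define u where "u = sqrt t"
  have u: "u \<ge> 0" "t = u\<^sup>2" "u \<noteq> d"
    using t td by (auto simp: u_def)
  have eq: "{h. h\<^sup>2 \<le> t} = {- u..u}"
    using t by (simp add: Collect_square_le u_def)
  \<comment> \<open>The squared distance decreases in \<open>h\<close>, and at the pole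
    \<open>h = u\<close> it equals \<open>(u - d)\<^sup>2\<close>, positive because the sphere
    misses the axis point.\<close>
  have pos: "t - 2 * d * h + d\<^sup>2 > 0" if "h \<le> u" for h
  proof -
    have "0 < (u - d)\<^sup>2" using u by simp
    also have "\<dots> = t - 2 * d * u + d\<^sup>2"
      by (simp add: u(2) power2_eq_square algebra_simps)
    also have "\<dots> \<le> t - 2 * d * h + d\<^sup>2"
      using that d by simp
    finally show ?thesis .
  qed
  have "((\<lambda>h. k (w h) / w h) has_integral (- P (w u) / d - (- P (w (- u)) / d))) {- u..u}"
  proof (rule fundamental_theorem_of_calculus)
    fix h assume h: "h \<in> {- u..u}"
    then have p: "t - 2 * d * h + d\<^sup>2 > 0" using pos by auto
    then have wp: "w h > 0" by (simp add: w_def)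
    have dw: "(w has_real_derivative - d / w h) (at h)"
      unfolding w_def using p by (auto intro!: derivative_eq_intros simp: field_simps)
    have "((\<lambda>h. - P (w h) / d) has_real_derivative k (w h) / w h) (at h)"
      using DERIV_chain2[OF P[OF wp] dw] d wp
      by (auto intro!: derivative_eq_intros simp: field_simps)
    then show "((\<lambda>h. - P (w h) / d) has_vector_derivative k (w h) / w h) (at h within {- u..u})"
      by (simp add: has_real_derivative_iff_has_vector_derivative has_vector_derivative_at_within)
  qed (use u in auto)
  then have "(\<integral>\<^sup>+h. ennreal (k (w h) / w h) * indicator {- u..u} h \<partial>lborel)
      = ennreal (- P (w u) / d - (- P (w (- u)) / d))"
    using pos by (intro nn_integral_has_integral_lebesgue') (auto simp: w_def intro!: divide_nonneg_pos k)
  moreover have "w u = \<bar>u - d\<bar>"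
  proof -
    have "t - 2 * d * u + d\<^sup>2 = (u - d)\<^sup>2"
      by (simp add: u(2) power2_eq_square algebra_simps)
    then show ?thesis by (simp add: w_def)
  qed
  moreover have "w (- u) = u + d"
  proof -
    have "t - 2 * d * (- u) + d\<^sup>2 = (u + d)\<^sup>2"
      by (simp add: u(2) power2_eq_square algebra_simps)
    then show ?thesis using u d by (simp add: w_def)
  qed
  ultimately show ?thesis
    unfolding eq by (simp add: w_def u_def diff_divide_distrib)
qed

text \<open>Slicing into spheres about \<open>p\<close> and integrating the kernel over each by its
  height in the direction of \<open>z\<close> leaves only values of the antiderivative
  \<open>P\<close>. Both the hyperbolic sine kernel and the decaying exponential kernel are handled
  this way.\<close>

lemma nn_integral_radial_kernel:
  fixes P k :: "real \<Rightarrow> real" and W :: "real \<Rightarrow> ennreal" and p z :: "real^3"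
  assumes [measurable]: "W \<in> borel_measurable borel" "k \<in> borel_measurable borel"
      "P \<in> borel_measurable borel"
    and zp: "z \<noteq> p"
    and P: "\<And>w. w > 0 \<Longrightarrow> (P has_real_derivative k w) (at w)"
    and k: "\<And>w. w > 0 \<Longrightarrow> 0 \<le> k w"
  shows "(\<integral>\<^sup>+x. W ((dist x p)\<^sup>2) * ennreal (k (dist x z) / dist x z) \<partial>lborel)
    = ennreal pi * (\<integral>\<^sup>+t. W t * ennreal ((P (sqrt t + dist z p) - P \<bar>sqrt t - dist z p\<bar>) / dist z p)
        * indicator {0..} t \<partial>lborel)"
proof -
  define d where "d = dist z p"
  define e where "e = (z - p) /\<^sub>R d"
  have d: "d > 0" using zp by (simp add: d_def)
  have e: "norm e = 1" and z: "z = p + d *\<^sub>R e"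
    using d by (simp_all add: e_def) (simp add: d_def dist_norm)
  have dz: "dist (p + x) z = sqrt ((norm x)\<^sup>2 - 2 * d * (x \<bullet> e) + d\<^sup>2)" for x
  proof -
    have "(dist (p + x) z)\<^sup>2 = (norm (x - d *\<^sub>R e))\<^sup>2"
      by (simp add: z dist_norm)
    also have "\<dots> = (norm x)\<^sup>2 - 2 * d * (x \<bullet> e) + d\<^sup>2"
      using e unfolding power2_norm_eq_inner
      by (simp add: inner_diff_left inner_diff_right inner_commute norm_eq_1 power2_eq_square algebra_simps)
    finally show ?thesis by (metis real_sqrt_unique zero_le_dist)
  qed
  define K where "K t h = ennreal (k (sqrt (t - 2 * d * h + d\<^sup>2)) / sqrt (t - 2 * d * h + d\<^sup>2))" for t h
  have [measurable]: "(\<lambda>q. K (fst q) (snd q)) \<in> borel_measurable (borel \<Otimes>\<^sub>M borel)"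
    unfolding K_def by measurable
  have [measurable]: "K t \<in> borel_measurable borel" for t
    unfolding K_def by measurable
  have inner: "(\<integral>\<^sup>+h. W t * K t h * indicator {h. h\<^sup>2 \<le> t} h \<partial>lborel)
      = W t * ennreal ((P (sqrt t + d) - P \<bar>sqrt t - d\<bar>) / d) * indicator {0..} t"
    if "t \<noteq> d\<^sup>2" for t
  proof (cases "t \<ge> 0")
    case True
    then show ?thesis
      using nn_integral_height_kernel[OF d True that P k, folded K_def]
      by (simp add: nn_integral_cmult mult.assoc)
  next
    case False
    then show ?thesis by (simp add: Collect_square_le)
  qed
  have "(\<integral>\<^sup>+x. W ((dist x p)\<^sup>2) * ennreal (k (dist x z) / dist x z) \<partial>lborel)
      = (\<integral>\<^sup>+x. W ((norm x)\<^sup>2) * K ((norm x)\<^sup>2) (x \<bullet> e) \<partial>lborel)"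
    by (subst nn_integral_lborel_plus[symmetric, where c=p]) (auto simp: dz K_def dist_norm[of "p + _" p])
  also have "\<dots> = ennreal pi * (\<integral>\<^sup>+t. (\<integral>\<^sup>+h. W t * K t h * indicator {h. h\<^sup>2 \<le> t} h \<partial>lborel) \<partial>lborel)"
    using nn_integral_norm_square_height[of "\<lambda>q. W (fst q) * K (fst q) (snd q)" e] e
    by (simp add: borel_prod[symmetric])
  also have "(\<integral>\<^sup>+t. (\<integral>\<^sup>+h. W t * K t h * indicator {h. h\<^sup>2 \<le> t} h \<partial>lborel) \<partial>lborel)
      = (\<integral>\<^sup>+t. W t * ennreal ((P (sqrt t + d) - P \<bar>sqrt t - d\<bar>) / d) * indicator {0..} t \<partial>lborel)"
  \<comment> \<open>Only the sphere through \<open>z\<close> itself, a single value of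
    \<open>t\<close>, escapes the height formula.\<close>
  proof (rule nn_integral_cong_AE)
    show "AE t in lborel. (\<integral>\<^sup>+h. W t * K t h * indicator {h. h\<^sup>2 \<le> t} h \<partial>lborel)
      = W t * ennreal ((P (sqrt t + d) - P \<bar>sqrt t - d\<bar>) / d) * indicator {0..} t"
      using AE_lborel_singleton[of "d\<^sup>2"] by eventually_elim (rule inner)
  qed
  finally show ?thesis by (simp add: d_def)
qed

text \<open>On a bounded set \<open>k\<close> is bounded, and the singularity 1/dist is absorbed by
  the radial density, which is proportional to \<open>sqrt t\<close>.\<close>

lemma set_integrable_radial_kernel:
  fixes k :: "real \<Rightarrow> real" and x :: "real^3"
  assumes D: "bounded D" "D \<in> sets borel" and k: "continuous_on UNIV k"
  shows "set_integrable lborel D (\<lambda>y. k (dist y x) / dist y x)"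
proof -
  note [measurable] = D(2) borel_measurable_continuous_onI[OF k]
  obtain R where R: "\<And>y. y \<in> D \<Longrightarrow> dist y x \<le> R" and R0: "R \<ge> 0"
    using D(1) by (metis bounded_any_center dist_commute dual_order.trans linear)
  have "compact (k ` {0..R})"
    by (intro compact_continuous_image continuous_on_subset[OF k]) auto
  then obtain C where C: "\<And>u. u \<in> {0..R} \<Longrightarrow> \<bar>k u\<bar> \<le> C"
    using compact_imp_bounded by (fastforce simp: bounded_iff)
  have C0: "C \<ge> 0" using C[of 0] R0 by force
  show ?thesis
    unfolding set_integrable_def
  proof (rule integrableI_bounded)
    have "(\<integral>\<^sup>+y. ennreal (norm (indicator D y *\<^sub>R (k (dist y x) / dist y x))) \<partial>lborel)
        \<le> (\<integral>\<^sup>+y. ennreal (C / sqrt ((dist y x)\<^sup>2)) * indicator {0..R\<^sup>2} ((dist y x)\<^sup>2) \<partial>lborel)"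
    proof (intro nn_integral_mono)
      fix y
      show "ennreal (norm (indicator D y *\<^sub>R (k (dist y x) / dist y x)))
        \<le> ennreal (C / sqrt ((dist y x)\<^sup>2)) * indicator {0..R\<^sup>2} ((dist y x)\<^sup>2)"
        using R[of y] C[of "dist y x"]
        by (auto split: split_indicator simp: power_mono divide_right_mono intro!: ennreal_leI)
    qed
    also have "\<dots> = ennreal pi * (\<integral>\<^sup>+t. ennreal (C / sqrt t) * indicator {0..R\<^sup>2} t * ennreal (2 * sqrt t) * indicator {0..} t \<partial>lborel)"
      by (rule nn_integral_radial) measurable
    also have "\<dots> \<le> ennreal pi * (\<integral>\<^sup>+t. ennreal (2 * C) * indicator {0..R\<^sup>2} t \<partial>lborel)"
      using C0 by (intro mult_left_mono nn_integral_mono)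
        (auto split: split_indicator simp: ennreal_mult[symmetric] intro!: ennreal_leI)
    also have "\<dots> < \<infinity>"
      by (subst nn_integral_cmult_indicator) (auto simp: ennreal_mult_less_top)
    finally show "(\<integral>\<^sup>+y. ennreal (norm (indicator D y *\<^sub>R (k (dist y x) / dist y x))) \<partial>lborel) < \<infinity>" .
  qed measurable
qed

section \<open>The coefficient\<close>

text \<open>Passing from k to k + 1 divides both sides by (k + 1)(k + 5/2). The right-hand side is
  shaped to match the power series of \<open>t * cosh t - sinh t\<close>.\<close>

lemma Gamma_half_quotient:
  "Gamma (5 / 2) / (fact k * Gamma (real k + 5 / 2)) = 4 ^ k * (3 * (2 * real k + 2) / fact (2 * k + 3))"
proof (induction k)
  case 0
  have "Gamma (5 / 2 :: real) \<noteq> 0"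
    using Gamma_real_pos[of "5 / 2"] by linarith
  then show ?case by (simp add: fact_numeral)
next
  case (Suc k)
  have "real k + 5 / 2 \<notin> \<int>\<^sub>\<le>\<^sub>0"
    using nonpos_Ints_nonpos[of "real k + 5 / 2"] by force
  then have G: "Gamma (real (Suc k) + 5 / 2) = (real k + 5 / 2) * Gamma (real k + 5 / 2)"
    using Gamma_plus1[of "real k + 5 / 2"] by (simp add: algebra_simps)
  have F: "(fact (2 * Suc k + 3) :: real) = (2 * real k + 5) * (2 * real k + 4) * fact (2 * k + 3)"
    by (simp add: numeral_eq_Suc algebra_simps)
  have "Gamma (5 / 2) / (fact (Suc k) * Gamma (real (Suc k) + 5 / 2))
      = (Gamma (5 / 2) / (fact k * Gamma (real k + 5 / 2))) / ((real k + 1) * (real k + 5 / 2))"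
    unfolding G by (simp add: algebra_simps)
  also have "\<dots> = 4 ^ k * (3 * (2 * real k + 2) / fact (2 * k + 3)) / ((real k + 1) * (real k + 5 / 2))"
    unfolding Suc.IH ..
  also have "\<dots> = 4 ^ Suc k * (3 * (2 * real (Suc k) + 2) / fact (2 * Suc k + 3))"
  proof -
    have *: "(3 * (2 * x + 2) / f) / ((x + 1) * (x + 5 / 2))
        = 4 * (3 * (2 * (1 + x) + 2) / ((2 * x + 5) * (2 * x + 4) * f))" if "x \<ge> 0" "f > 0" for x f :: real
      using that by (simp add: divide_simps add_nonneg_eq_0_iff) (simp add: algebra_simps)
    have **: "4 ^ k * a / b = 4 ^ Suc k * c" if "a / b = 4 * c" for a b c :: real
    proof -
      have "4 ^ k * a / b = 4 ^ k * (a / b)" by simp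
      also have "\<dots> = 4 ^ Suc k * c" unfolding that by simp
      finally show ?thesis .
    qed
    show ?thesis
      unfolding F of_nat_Suc by (rule **[OF *]) simp_all
  qed
  finally show ?case .
qed

text \<open>Both sides are compared term by term as power series; the half-integer order makes the
  Bessel coefficients collapse to factorials.\<close>

lemma a3_plus_eq:
  assumes t: "t > 0"
  shows "a3_plus t = 3 * (t * cosh t - sinh t) / t ^ 3"
proof -
  have "(\<lambda>n. (if even n then t ^ n /\<^sub>R fact n else 0)) sums cosh t"
    using cosh_converges[of t] by (simp add: if_distrib)
  then have "(\<lambda>k. (if even (2 * k) then t ^ (2 * k) /\<^sub>R fact (2 * k) else 0)) sums cosh t"
    by (subst sums_mono_reindex[of "\<lambda>k. 2 * k"]) (auto simp: strict_mono_def elim!: evenE)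
  then have c: "(\<lambda>k. t ^ (2 * k) / fact (2 * k)) sums cosh t"
    by (simp add: divide_inverse_commute)
  have "(\<lambda>n. (if even n then 0 else t ^ n /\<^sub>R fact n)) sums sinh t"
    using sinh_converges[of t] by (simp add: if_distrib)
  then have "(\<lambda>k. (if even (2 * k + 1) then 0 else t ^ (2 * k + 1) /\<^sub>R fact (2 * k + 1))) sums sinh t"
    by (subst sums_mono_reindex[of "\<lambda>k. 2 * k + 1"]) (auto simp: strict_mono_def elim!: oddE)
  then have s: "(\<lambda>k. t ^ (2 * k + 1) / fact (2 * k + 1)) sums sinh t"
    by (simp add: divide_inverse_commute)
  \<comment> \<open>Here 1/(2k)! - 1/(2k+1)! = 2k/(2k+1)!. The term at k = 0 vanishes, so the series
    may start at k = 1, and this shift aligns it with the Bessel series.\<close>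
  define f where "f k = t ^ (2 * k + 1) * (2 * real k / fact (2 * k + 1))" for k
  have "(\<lambda>k. t * (t ^ (2 * k) / fact (2 * k)) - t ^ (2 * k + 1) / fact (2 * k + 1)) sums (t * cosh t - sinh t)"
    by (intro sums_diff sums_mult c s)
  also have "(\<lambda>k. t * (t ^ (2 * k) / fact (2 * k)) - t ^ (2 * k + 1) / fact (2 * k + 1)) = f"
  proof
    fix k
    have "t * (a / b) - t * a / ((x + 1) * b) = t * a * (x / ((x + 1) * b))" if "x \<ge> 0" "b > 0" for a b x :: real
      using that by (simp add: divide_simps add_nonneg_eq_0_iff) (simp add: algebra_simps)
    from this[of "2 * real k" "fact (2 * k)" "t ^ (2 * k)"]
    show "t * (t ^ (2 * k) / fact (2 * k)) - t ^ (2 * k + 1) / fact (2 * k + 1) = f k"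
      by (simp add: f_def algebra_simps)
  qed
  finally have f: "f sums (t * cosh t - sinh t)" .
  have f0: "f 0 = 0" by (simp add: f_def)
  from f have "(\<lambda>k. f (Suc k)) sums (t * cosh t - sinh t)"
    by (simp add: sums_Suc_iff f0)
  then have S: "(\<lambda>k. 3 / t ^ 3 * f (Suc k)) sums (3 / t ^ 3 * (t * cosh t - sinh t))"
    by (rule sums_mult)
  have p: "(t / 2) powr (3 / 2) > 0" using t by simp
  have G: "Gamma (5 / 2 :: real) \<noteq> 0"
    using Gamma_real_pos[of "5 / 2"] by linarith
  have trm: "(t / 2) powr (2 * real k + 3 / 2) / (fact k * Gamma (real k + 3 / 2 + 1))
      = (t / 2) powr (3 / 2) / Gamma (5 / 2) * (3 / t ^ 3 * f (Suc k))" for k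
  proof -
    have "(t / 2) powr (2 * real k + 3 / 2) = (t / 2) ^ (2 * k) * (t / 2) powr (3 / 2)"
      using t powr_realpow[of "t / 2" "2 * k"] by (simp add: powr_add)
    also have "(t / 2) ^ (2 * k) = t ^ (2 * k) / 4 ^ k"
      by (simp add: power_divide power_mult)
    finally have 1: "(t / 2) powr (2 * real k + 3 / 2) = t ^ (2 * k) / 4 ^ k * (t / 2) powr (3 / 2)" .
    have 2: "1 / (fact k * Gamma (real k + 3 / 2 + 1))
        = 4 ^ k * (3 * (2 * real k + 2) / fact (2 * k + 3)) / Gamma (5 / 2)"
      using Gamma_half_quotient[of k] G by (simp add: field_simps)
    have 3: "3 / t ^ 3 * f (Suc k) = t ^ (2 * k) * (3 * (2 * real k + 2) / fact (2 * k + 3))"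
    proof -
      have e: "t ^ (2 * Suc k + 1) = t ^ 3 * t ^ (2 * k)"
        by (simp add: power_add[symmetric] numeral_eq_Suc)
      have n: "2 * Suc k + 1 = 2 * k + 3" by simp
      have "f (Suc k) = t ^ 3 * t ^ (2 * k) * ((2 * real k + 2) / fact (2 * k + 3))"
        unfolding f_def e unfolding n by (simp add: add.commute)
      then show ?thesis using t by simp
    qed
    have "(t / 2) powr (2 * real k + 3 / 2) / (fact k * Gamma (real k + 3 / 2 + 1))
        = (t / 2) powr (2 * real k + 3 / 2) * (1 / (fact k * Gamma (real k + 3 / 2 + 1)))"
      by simp
    also have "\<dots> = (t / 2) powr (3 / 2) / Gamma (5 / 2) * (3 / t ^ 3 * f (Suc k))"
      unfolding 1 2 3 by (simp add: mult_ac)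
    finally show ?thesis .
  qed
  have "bessel_I (3 / 2) t = (t / 2) powr (3 / 2) / Gamma (5 / 2) * (3 / t ^ 3 * (t * cosh t - sinh t))"
    unfolding bessel_I_def trm by (intro sums_unique[symmetric] sums_mult S)
  then show ?thesis
    unfolding a3_plus_def using p G by simp
qed

section \<open>The kernel of the regular solution\<close>

text \<open>The difference vanishes at 0 and has derivative \<open>y * sinh y\<close>. This
  inequality yields both the positivity of the coefficient and the monotonicity of the
  kernel.\<close>

lemma sinh_less_mult_cosh:
  fixes x :: real
  assumes "x > 0"
  shows "sinh x < x * cosh x"
proof -
  have "0 * cosh 0 - sinh 0 < x * cosh x - sinh x"
  proof (rule DERIV_pos_imp_increasing_open[OF assms])
    fix y :: real assume "0 < y" "y < x"
    then show "\<exists>D. ((\<lambda>y. y * cosh y - sinh y) has_real_derivative D) (at y) \<and> D > 0"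
      by (intro exI[of _ "y * sinh y"] conjI) (auto intro!: derivative_eq_intros)
  qed (auto intro!: continuous_intros)
  then show ?thesis by simp
qed

lemma sinh_mult_divide_strict_mono:
  fixes \<mu> u v :: real
  assumes \<mu>: "\<mu> > 0" and u: "0 < u" and uv: "u < v"
  shows "sinh (\<mu> * u) / u < sinh (\<mu> * v) / v"
proof (rule DERIV_pos_imp_increasing[OF uv])
  fix y assume "u \<le> y" "y \<le> v"
  then have y: "y > 0" using u by simp
  have "((\<lambda>y. sinh (\<mu> * y) / y) has_real_derivative (\<mu> * y * cosh (\<mu> * y) - sinh (\<mu> * y)) / (y * y)) (at y)"
    using y by (auto intro!: derivative_eq_intros)
  moreover have "(\<mu> * y * cosh (\<mu> * y) - sinh (\<mu> * y)) / (y * y) > 0"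
    using sinh_less_mult_cosh[of "\<mu> * y"] y \<mu> by simp
  ultimately show "\<exists>D. ((\<lambda>y. sinh (\<mu> * y) / y) has_real_derivative D) (at y) \<and> D > 0"
    by blast
qed

lemma borel_measurable_sinh_real [measurable (raw)]:
  fixes f :: "'a \<Rightarrow> real"
  assumes "f \<in> borel_measurable M"
  shows "(\<lambda>x. sinh (f x)) \<in> borel_measurable M"
  by (rule measurable_compose[OF assms]) (intro borel_measurable_continuous_onI continuous_intros)

lemma borel_measurable_cosh_real [measurable (raw)]:
  fixes f :: "'a \<Rightarrow> real"
  assumes "f \<in> borel_measurable M"
  shows "(\<lambda>x. cosh (f x)) \<in> borel_measurable M"
  by (rule measurable_compose[OF assms]) (intro borel_measurable_continuous_onI continuous_intros)

lemma nn_integral_sinh_kernel_center: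
  fixes p :: "real^3"
  assumes [measurable]: "W \<in> borel_measurable borel" and \<mu>: "\<mu> > 0"
  shows "(\<integral>\<^sup>+x. W ((dist x p)\<^sup>2) * ennreal (sinh (\<mu> * dist x p) / dist x p) \<partial>lborel)
    = ennreal pi * (\<integral>\<^sup>+t. W t * ennreal (2 * sinh (\<mu> * sqrt t)) * indicator {0..} t \<partial>lborel)"
proof -
  have "(\<integral>\<^sup>+x. W ((dist x p)\<^sup>2) * ennreal (sinh (\<mu> * dist x p) / dist x p) \<partial>lborel)
    = (\<integral>\<^sup>+x. W ((dist x p)\<^sup>2) * ennreal (sinh (\<mu> * sqrt ((dist x p)\<^sup>2)) / sqrt ((dist x p)\<^sup>2)) \<partial>lborel)"
    by simp
  also have "\<dots> = ennreal pi * (\<integral>\<^sup>+t. W t * ennreal (sinh (\<mu> * sqrt t) / sqrt t)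
        * ennreal (2 * sqrt t) * indicator {0..} t \<partial>lborel)"
    by (rule nn_integral_radial) measurable
  also have "(\<integral>\<^sup>+t. W t * ennreal (sinh (\<mu> * sqrt t) / sqrt t)
        * ennreal (2 * sqrt t) * indicator {0..} t \<partial>lborel)
      = (\<integral>\<^sup>+t. W t * ennreal (2 * sinh (\<mu> * sqrt t)) * indicator {0..} t \<partial>lborel)"
    using \<mu> by (intro nn_integral_cong)
      (auto split: split_indicator simp: mult.assoc mult.commute[of _ 2] ennreal_mult[symmetric])
  finally show ?thesis .
qed

text \<open>The mean value property about \<open>p\<close>, for all radial weights \<open>W\<close> at once.\<close>

lemma nn_integral_sinh_kernel:
  fixes p z :: "real^3"
  assumes [measurable]: "W \<in> borel_measurable borel" and \<mu>: "\<mu> > 0" and zp: "z \<noteq> p"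
  shows "(\<integral>\<^sup>+x. W ((dist x p)\<^sup>2) * ennreal (sinh (\<mu> * dist x z) / dist x z) \<partial>lborel)
    = ennreal (sinh (\<mu> * dist z p) / (\<mu> * dist z p))
      * (\<integral>\<^sup>+x. W ((dist x p)\<^sup>2) * ennreal (sinh (\<mu> * dist x p) / dist x p) \<partial>lborel)"
proof -
  define d where "d = dist z p"
  have d: "d > 0" using zp by (simp add: d_def)
  have "(\<integral>\<^sup>+x. W ((dist x p)\<^sup>2) * ennreal (sinh (\<mu> * dist x z) / dist x z) \<partial>lborel)
    = ennreal pi * (\<integral>\<^sup>+t. W t * ennreal ((cosh (\<mu> * (sqrt t + d)) / \<mu> - cosh (\<mu> * \<bar>sqrt t - d\<bar>) / \<mu>) / d)
        * indicator {0..} t \<partial>lborel)"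
    unfolding d_def
    by (rule nn_integral_radial_kernel[where k="\<lambda>w. sinh (\<mu> * w)" and P="\<lambda>w. cosh (\<mu> * w) / \<mu>"])
       (use \<mu> zp in \<open>auto intro!: derivative_eq_intros\<close>)
  also have "(\<integral>\<^sup>+t. W t * ennreal ((cosh (\<mu> * (sqrt t + d)) / \<mu> - cosh (\<mu> * \<bar>sqrt t - d\<bar>) / \<mu>) / d)
        * indicator {0..} t \<partial>lborel)
      = (\<integral>\<^sup>+t. ennreal (sinh (\<mu> * d) / (\<mu> * d)) * (W t * ennreal (2 * sinh (\<mu> * sqrt t)) * indicator {0..} t) \<partial>lborel)"
  proof (intro nn_integral_cong)
    fix t :: real
    \<comment> \<open>Evenness of \<open>cosh\<close> removes the absolute value, so spheres on
      either side of \<open>z\<close> obey one formula; the addition theorem then factors it into a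
      part in \<open>t\<close> and a part in \<open>d\<close>.\<close>
    have "cosh (\<mu> * \<bar>sqrt t - d\<bar>) = cosh (\<mu> * (sqrt t - d))"
      using \<mu> cosh_real_abs[of "\<mu> * (sqrt t - d)"] by (simp add: abs_mult)
    then have "cosh (\<mu> * (sqrt t + d)) - cosh (\<mu> * \<bar>sqrt t - d\<bar>) = 2 * sinh (\<mu> * sqrt t) * sinh (\<mu> * d)"
      by (simp add: ring_distribs cosh_add cosh_diff)
    moreover have "(a / \<mu> - b / \<mu>) / d = (a - b) / (\<mu> * d)" for a b
      by (simp add: diff_divide_distrib)
    ultimately have eq: "(cosh (\<mu> * (sqrt t + d)) / \<mu> - cosh (\<mu> * \<bar>sqrt t - d\<bar>) / \<mu>) / d
        = sinh (\<mu> * d) / (\<mu> * d) * (2 * sinh (\<mu> * sqrt t))"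
      by simp
    then show "W t * ennreal ((cosh (\<mu> * (sqrt t + d)) / \<mu> - cosh (\<mu> * \<bar>sqrt t - d\<bar>) / \<mu>) / d) * indicator {0..} t
        = ennreal (sinh (\<mu> * d) / (\<mu> * d)) * (W t * ennreal (2 * sinh (\<mu> * sqrt t)) * indicator {0..} t)"
    proof (cases "t \<ge> 0")
      case True
      have "ennreal (sinh (\<mu> * d) / (\<mu> * d) * (2 * sinh (\<mu> * sqrt t)))
          = ennreal (sinh (\<mu> * d) / (\<mu> * d)) * ennreal (2 * sinh (\<mu> * sqrt t))"
        using \<mu> d True by (intro ennreal_mult) auto
      then show ?thesis
        unfolding eq by (simp only: mult_ac)
    qed simp
  qed
  also have "\<dots> = ennreal (sinh (\<mu> * d) / (\<mu> * d)) * (\<integral>\<^sup>+t. W t * ennreal (2 * sinh (\<mu> * sqrt t)) * indicator {0..} t \<partial>lborel)"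
    by (rule nn_integral_cmult) measurable
  finally show ?thesis
    unfolding nn_integral_sinh_kernel_center[OF assms(1,2)] d_def by (simp add: mult_ac)
qed

text \<open>This identifies \<open>a3_plus (\<mu> * r)\<close> as the mean of sinh (\<mu> rho) /
  (\<mu> rho) over the ball, the constant in its mean value property.\<close>

lemma nn_integral_sinh_kernel_cball:
  fixes p :: "real^3"
  assumes \<mu>: "\<mu> > 0" and r: "r > 0"
  shows "(\<integral>\<^sup>+x. indicator {..r\<^sup>2} ((dist x p)\<^sup>2) * ennreal (sinh (\<mu> * dist x p) / dist x p) \<partial>lborel)
    = ennreal (a3_plus (\<mu> * r) * measure lborel (ball p r) * \<mu>)"
proof -
  \<comment> \<open>Found by substituting t = u^2 and integrating by parts. The square root is not
    differentiable at 0, hence the version of the fundamental theorem that differentiates only in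
    the interior.\<close>
  let ?G = "\<lambda>t. 4 * sqrt t * cosh (\<mu> * sqrt t) / \<mu> - 4 * sinh (\<mu> * sqrt t) / \<mu>\<^sup>2"
  have "((\<lambda>t. 2 * sinh (\<mu> * sqrt t)) has_integral (?G (r\<^sup>2) - ?G 0)) {0..r\<^sup>2}"
  proof (rule fundamental_theorem_of_calculus_interior)
    show "continuous_on {0..r\<^sup>2} ?G"
      using \<mu> by (intro continuous_intros) auto
    fix t assume "t \<in> {0<..<r\<^sup>2}"
    then have "(?G has_real_derivative 2 * sinh (\<mu> * sqrt t)) (at t)"
      using \<mu> by (auto intro!: derivative_eq_intros simp: power2_eq_square field_simps)
    then show "(?G has_vector_derivative 2 * sinh (\<mu> * sqrt t)) (at t)"
      by (simp add: has_real_derivative_iff_has_vector_derivative)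
  qed (use r in simp)
  then have i1: "(\<integral>\<^sup>+t. ennreal (2 * sinh (\<mu> * sqrt t)) * indicator {0..r\<^sup>2} t \<partial>lborel) = ennreal (?G (r\<^sup>2) - ?G 0)"
    using \<mu> by (intro nn_integral_has_integral_lebesgue') auto
  have i2: "(\<integral>\<^sup>+x. indicator {..r\<^sup>2} ((dist x p)\<^sup>2) * ennreal (sinh (\<mu> * dist x p) / dist x p) \<partial>lborel)
      = ennreal pi * (\<integral>\<^sup>+t. ennreal (2 * sinh (\<mu> * sqrt t)) * indicator {0..r\<^sup>2} t \<partial>lborel)"
  proof -
    have "indicator {..r\<^sup>2} t * ennreal (2 * sinh (\<mu> * sqrt t)) * indicator {0..} t
      = ennreal (2 * sinh (\<mu> * sqrt t)) * indicator {0..r\<^sup>2} t" for t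
      by (auto split: split_indicator)
    then show ?thesis
      by (simp add: nn_integral_sinh_kernel_center[OF _ \<mu>])
  qed
  have i3: "pi * (?G (r\<^sup>2) - ?G 0) = a3_plus (\<mu> * r) * measure lborel (ball p r) * \<mu>"
    using \<mu> r by (simp add: a3_plus_eq content_ball unit_ball_vol_3)
      (simp add: field_simps power2_eq_square power3_eq_cube)
  show ?thesis
    unfolding i2 i1 i3[symmetric] by (rule ennreal_mult'[symmetric]) simp
qed

section \<open>Recovering the ball\<close>

text \<open>Nonempty open sets are not negligible; this turns almost-everywhere statements about
  open sets into exact ones.\<close>

lemma AE_notin_open_imp_empty:
  fixes U :: "'a::euclidean_space set"
  assumes "open U" "AE x in lborel. x \<notin> U"
  shows "U = {}"
proof (rule ccontr)
  assume "U \<noteq> {}"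
  have "U \<in> null_sets lborel"
    using assms by (simp add: AE_iff_null_sets)
  then have "negligible U"
    by (simp add: negligible_iff_null_sets null_sets_completionI)
  with \<open>U \<noteq> {}\<close> assms(1) show False
    by (simp add: open_not_negligible)
qed


text \<open>A bathtub argument: among sets of given volume, the ball about \<open>p\<close>
  minimises the integral of an increasing function of the distance, uniquely up to null
  sets.\<close>

lemma AE_eq_cball_if_radial_integral_eq:
  fixes f :: "real \<Rightarrow> real" and p :: "'a::euclidean_space"
  assumes f: "\<And>u v. 0 < u \<Longrightarrow> u < v \<Longrightarrow> f u < f v" and r: "r > 0"
    and D: "D \<in> sets borel" "emeasure lborel D < \<infinity>" "p \<in> D"
    and vol: "measure lborel D = measure lborel (cball p r)"
    and int: "set_integrable lborel D (\<lambda>y. f (dist y p))" "set_integrable lborel (cball p r) (\<lambda>y. f (dist y p))"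
    and eq: "(LINT y:D|lborel. f (dist y p)) = (LINT y:cball p r|lborel. f (dist y p))"
  shows "AE y in lborel. y \<in> D \<longleftrightarrow> y \<in> cball p r"
proof -
  define I :: "'a \<Rightarrow> real" where "I y = indicator D y - indicator (cball p r) y" for y
  have iD: "integrable lborel (\<lambda>y. f r * indicator D y)"
    using D by (intro integrable_mult_right integrable_real_indicator) auto
  have iC: "integrable lborel (\<lambda>y. f r * indicator (cball p r) y)"
    by (intro integrable_mult_right integrable_real_indicator emeasure_bounded_finite) auto
  note int' = int[unfolded set_integrable_def real_scaleR_def]
  \<comment> \<open>Subtracting the constant \<open>f r\<close> does not change the difference of
    the integrals, because the volumes agree.\<close>
  have g: "(f (dist y p) - f r) * I y = (indicator D y * f (dist y p) - indicator (cball p r) y * f (dist y p))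
      - (f r * indicator D y - f r * indicator (cball p r) y)" for y
    by (simp add: I_def algebra_simps)
  have "(LINT y|lborel. (f (dist y p) - f r) * I y) = 0"
    unfolding g using eq vol D int' iD iC
    by (simp add: Bochner_Integration.integral_diff Bochner_Integration.integrable_diff set_lebesgue_integral_def)
  moreover have "integrable lborel (\<lambda>y. (f (dist y p) - f r) * I y)"
    unfolding g by (intro Bochner_Integration.integrable_diff int' iD iC)
  \<comment> \<open>Both factors change sign across the sphere. At \<open>y = p\<close> nothing is
    known about \<open>f 0\<close>, but \<open>p\<close> lies in both sets and so
    \<open>I p = 0\<close>.\<close>
  moreover have nn: "0 \<le> (f (dist y p) - f r) * I y" for y
  proof -
    consider "y = p" | "0 < dist y p" "dist y p < r" | "dist y p = r" | "r < dist y p"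
      by (metis linorder_neqE_linordered_idom zero_less_dist_iff)
    then show ?thesis
      using f[of "dist y p" r] f[of r "dist y p"] r D(3)
      by cases (auto simp: I_def dist_commute mult_le_0_iff zero_le_mult_iff split: split_indicator)
  qed
  ultimately have "AE y in lborel. (f (dist y p) - f r) * I y = 0"
    using integral_nonneg_eq_0_iff_AE[of lborel "\<lambda>y. (f (dist y p) - f r) * I y"] by simp
  moreover have "AE y in lborel. y \<notin> sphere p r"
  proof (rule AE_not_in)
    show "sphere p r \<in> null_sets lborel"
      using negligible_sphere[of p r] by (auto simp: null_sets_completion_iff negligible_iff_null_sets)
  qed
  ultimately show ?thesis
  proof eventually_elim
    case (elim y)
    have "y = p \<or> f (dist y p) \<noteq> f r"
      using f[of "dist y p" r] f[of r "dist y p"] r elim(2)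
      by (metis dist_commute dist_eq_0_iff less_irrefl linorder_neqE_linordered_idom mem_sphere zero_less_dist_iff)
    with elim(1) r D(3) show ?case
      by (auto simp: I_def split: split_indicator_asm)
  qed
qed

text \<open>After exchanging the integrations over a shell and over \<open>D\<close>, the mean value
  property turns the integral over the shell into a multiple of one number \<open>N\<close>, for
  almost every source point in \<open>D\<close>. Cancelling \<open>N\<close> leaves the value at the
  centre.\<close>

lemma sinh_potential_center:
  fixes p :: "real^3"
  assumes \<mu>: "\<mu> > 0" and D: "open D" "bounded D" and c: "c \<ge> 0"
    and pot: "\<And>x. x \<notin> D \<Longrightarrow> (\<integral>\<^sup>+y. indicator D y * ennreal (sinh (\<mu> * dist x y) / dist x y) \<partial>lborel)
        = ennreal c * ennreal (sinh (\<mu> * dist x p) / dist x p)"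
  shows "(\<integral>\<^sup>+y. indicator D y * ennreal (sinh (\<mu> * dist y p) / (\<mu> * dist y p)) \<partial>lborel) = ennreal c"
proof -
  have [measurable]: "D \<in> sets borel" using D by simp
  obtain R where R: "\<And>y. y \<in> D \<Longrightarrow> dist y p \<le> R" and R0: "R \<ge> 0"
    using D(2) by (metis bounded_any_center dist_commute dual_order.trans linear)
  \<comment> \<open>The weight of the shell between radii \<open>R\<close> and \<open>R + 1\<close>;
    since \<open>D\<close> lies in the closed ball of radius \<open>R\<close>, the exterior identity
    holds throughout the shell.\<close>
  define W :: "real \<Rightarrow> ennreal" where "W = indicator {R\<^sup>2<..<(R + 1)\<^sup>2}"
  have [measurable]: "W \<in> borel_measurable borel" by (simp add: W_def)
  define N where "N = (\<integral>\<^sup>+x. W ((dist x p)\<^sup>2) * ennreal (sinh (\<mu> * dist x p) / dist x p) \<partial>lborel)"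
  have out: "x \<notin> D" if "W ((dist x p)\<^sup>2) \<noteq> 0" for x
  proof
    assume "x \<in> D"
    then have "(dist x p)\<^sup>2 \<le> R\<^sup>2" using R by (simp add: power_mono)
    with that show False by (simp add: W_def indicator_def split: if_splits)
  qed
  \<comment> \<open>Cancelling \<open>N\<close> at the end is a division in \<open>ennreal\<close>,
    which is valid only if \<open>N\<close> is neither infinite nor 0.\<close>
  have N_fin: "N \<noteq> \<infinity>"
  proof -
    have "set_integrable lborel (cball p (R + 1)) (\<lambda>y. sinh (\<mu> * dist y p) / dist y p)"
      by (intro set_integrable_radial_kernel[where k="\<lambda>u. sinh (\<mu> * u)"] continuous_intros) auto
    then have fin: "(\<integral>\<^sup>+x. ennreal (norm (indicator (cball p (R + 1)) x *\<^sub>R (sinh (\<mu> * dist x p) / dist x p))) \<partial>lborel) < \<infinity>"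
      by (simp add: set_integrable_def integrable_iff_bounded)
    have "N \<le> (\<integral>\<^sup>+x. ennreal (norm (indicator (cball p (R + 1)) x *\<^sub>R (sinh (\<mu> * dist x p) / dist x p))) \<partial>lborel)"
      unfolding N_def W_def
    proof (intro nn_integral_mono)
      fix x
      have "dist x p \<le> R + 1" if "(dist x p)\<^sup>2 < (R + 1)\<^sup>2"
        using that R0 by (meson add_nonneg_nonneg less_imp_le power2_less_imp_less zero_le_one)
      then show "indicator {R\<^sup>2<..<(R + 1)\<^sup>2} ((dist x p)\<^sup>2) * ennreal (sinh (\<mu> * dist x p) / dist x p)
        \<le> ennreal (norm (indicator (cball p (R + 1)) x *\<^sub>R (sinh (\<mu> * dist x p) / dist x p)))"
        using \<mu> by (auto split: split_indicator simp: dist_commute)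
    qed
    with fin show ?thesis by auto
  qed
  have N_pos: "N \<noteq> 0"
  proof
    assume "N = 0"
    then have "AE x in lborel. W ((dist x p)\<^sup>2) * ennreal (sinh (\<mu> * dist x p) / dist x p) = 0"
      unfolding N_def by (subst (asm) nn_integral_0_iff_AE) auto
    then have "AE x in lborel. x \<notin> {x. R\<^sup>2 < (dist x p)\<^sup>2} \<inter> {x. (dist x p)\<^sup>2 < (R + 1)\<^sup>2}"
    proof eventually_elim
      case (elim x)
      show ?case
      proof
        assume x: "x \<in> {x. R\<^sup>2 < (dist x p)\<^sup>2} \<inter> {x. (dist x p)\<^sup>2 < (R + 1)\<^sup>2}"
        then have "x \<noteq> p" using R0 by auto
        then have "sinh (\<mu> * dist x p) / dist x p > 0" using \<mu> by simp
        with x elim show False by (simp add: W_def ennreal_eq_0_iff)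
      qed
    qed
    moreover have "open ({x. R\<^sup>2 < (dist x p)\<^sup>2} \<inter> {x. (dist x p)\<^sup>2 < (R + 1)\<^sup>2})"
      by (intro open_Int open_Collect_less continuous_intros)
    ultimately have "{x. R\<^sup>2 < (dist x p)\<^sup>2} \<inter> {x. (dist x p)\<^sup>2 < (R + 1)\<^sup>2} = {}"
      by (intro AE_notin_open_imp_empty)
    moreover have "p + (R + 1 / 2) *\<^sub>R axis 1 1 \<in> {x. R\<^sup>2 < (dist x p)\<^sup>2} \<inter> {x. (dist x p)\<^sup>2 < (R + 1)\<^sup>2}"
      using R0 by (auto simp: dist_norm intro!: power_strict_mono)
    ultimately show False by blast
  qed
  let ?s = "\<lambda>x y. ennreal (sinh (\<mu> * dist x y) / dist x y)"
  have "ennreal c * N = (\<integral>\<^sup>+x. W ((dist x p)\<^sup>2) * (ennreal c * ?s x p) \<partial>lborel)"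
    unfolding N_def by (subst nn_integral_cmult[symmetric]) (auto simp: mult_ac)
  also have "\<dots> = (\<integral>\<^sup>+x. W ((dist x p)\<^sup>2) * (\<integral>\<^sup>+y. indicator D y * ?s x y \<partial>lborel) \<partial>lborel)"
  proof (rule nn_integral_cong)
    fix x
    show "W ((dist x p)\<^sup>2) * (ennreal c * ?s x p) = W ((dist x p)\<^sup>2) * (\<integral>\<^sup>+y. indicator D y * ?s x y \<partial>lborel)"
      by (cases "W ((dist x p)\<^sup>2) = 0") (simp_all add: pot[OF out])
  qed
  also have "\<dots> = (\<integral>\<^sup>+x. (\<integral>\<^sup>+y. W ((dist x p)\<^sup>2) * (indicator D y * ?s x y) \<partial>lborel) \<partial>lborel)"
    by (intro nn_integral_cong nn_integral_cmult[symmetric]) measurable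
  also have "\<dots> = (\<integral>\<^sup>+y. (\<integral>\<^sup>+x. W ((dist x p)\<^sup>2) * (indicator D y * ?s x y) \<partial>lborel) \<partial>lborel)"
    by (rule lborel_pair.Fubini') measurable
  also have "\<dots> = (\<integral>\<^sup>+y. indicator D y * (\<integral>\<^sup>+x. W ((dist x p)\<^sup>2) * ?s x y \<partial>lborel) \<partial>lborel)"
    by (subst nn_integral_cmult[symmetric]) (auto simp: mult_ac)
  also have "\<dots> = (\<integral>\<^sup>+y. indicator D y * ennreal (sinh (\<mu> * dist y p) / (\<mu> * dist y p)) * N \<partial>lborel)"
  proof (rule nn_integral_cong_AE)
    show "AE y in lborel. indicator D y * (\<integral>\<^sup>+x. W ((dist x p)\<^sup>2) * ?s x y \<partial>lborel)
      = indicator D y * ennreal (sinh (\<mu> * dist y p) / (\<mu> * dist y p)) * N"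
      using AE_lborel_singleton[of p]
      by eventually_elim (simp add: nn_integral_sinh_kernel[OF _ \<mu>] N_def mult.assoc)
  qed
  also have "\<dots> = (\<integral>\<^sup>+y. indicator D y * ennreal (sinh (\<mu> * dist y p) / (\<mu> * dist y p)) \<partial>lborel) * N"
    by (rule nn_integral_multc) measurable
  finally have "ennreal c * N / N = (\<integral>\<^sup>+y. indicator D y * ennreal (sinh (\<mu> * dist y p) / (\<mu> * dist y p)) \<partial>lborel) * N / N"
    by simp
  then show ?thesis
    using N_fin N_pos by (simp add: ennreal_mult_divide_eq)
qed

text \<open>Inside the ball, its Yukawa potential is strictly smaller than that of the point mass at the
  centre that generates the same exterior potential; hence the integrals below cannot agree.\<close>

lemma nn_integral_yukawa_kernel_cball_neq:
  fixes p z :: "real^3"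
  assumes \<mu>: "\<mu> > 0" and z: "z \<noteq> p" "dist z p < r"
  shows "(\<integral>\<^sup>+x. indicator {..r\<^sup>2} ((dist x p)\<^sup>2) * ennreal (exp (- \<mu> * dist x z) / dist x z) \<partial>lborel)
    \<noteq> ennreal (exp (- \<mu> * dist z p) / (\<mu> * dist z p))
      * (\<integral>\<^sup>+x. indicator {..r\<^sup>2} ((dist x p)\<^sup>2) * ennreal (sinh (\<mu> * dist x p) / dist x p) \<partial>lborel)"
    (is "?L \<noteq> ennreal ?q * ?S")
proof
  assume eq: "?L = ennreal ?q * ?S"
  define d where "d = dist z p"
  have d: "d > 0" "d < r" using z by (simp_all add: d_def)
  then have r: "r > 0" by simp
  \<comment> \<open>\<open>f\<close> and \<open>g\<close> are the densities, in the squared radius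
    \<open>t\<close>, of the two sides up to the factor \<open>pi\<close>, so the comparison becomes
    one-dimensional.\<close>
  define f where "f t = indicator {..r\<^sup>2} t
    * ennreal ((- exp (- \<mu> * (sqrt t + d)) / \<mu> - - exp (- \<mu> * \<bar>sqrt t - d\<bar>) / \<mu>) / d) * indicator {0..} t" for t
  define g where "g t = ennreal ?q * (indicator {..r\<^sup>2} t * ennreal (2 * sinh (\<mu> * sqrt t)) * indicator {0..} t)" for t
  have [measurable]: "f \<in> borel_measurable borel" "g \<in> borel_measurable borel"
    unfolding f_def g_def by measurable
  have L: "?L = ennreal pi * (\<integral>\<^sup>+t. f t \<partial>lborel)"
    unfolding d_def f_def
    by (rule nn_integral_radial_kernel[where k="\<lambda>w. exp (- \<mu> * w)" and P="\<lambda>w. - exp (- \<mu> * w) / \<mu>"])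
       (use \<mu> z in \<open>auto intro!: derivative_eq_intros\<close>)
  have S: "ennreal ?q * ?S = ennreal pi * (\<integral>\<^sup>+t. g t \<partial>lborel)"
    unfolding g_def
    by (subst nn_integral_cmult) (simp_all add: nn_integral_sinh_kernel_center[OF _ \<mu>] mult.left_commute)
  have fg: "(\<integral>\<^sup>+t. f t \<partial>lborel) = (\<integral>\<^sup>+t. g t \<partial>lborel)"
  proof -
    have "(\<integral>\<^sup>+t. f t \<partial>lborel) * ennreal pi / ennreal pi = (\<integral>\<^sup>+t. g t \<partial>lborel) * ennreal pi / ennreal pi"
      using eq unfolding L S by (simp only: mult.commute)
    then show ?thesis
      by (subst (asm) (1 2) ennreal_mult_divide_eq) (simp_all add: ennreal_eq_0_iff not_le)
  qed
  have "ennreal pi * (\<integral>\<^sup>+t. f t \<partial>lborel) < \<infinity>"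
    unfolding L[symmetric] eq nn_integral_sinh_kernel_cball[OF \<mu> r] by (simp add: ennreal_mult_less_top)
  then have fin: "(\<integral>\<^sup>+t. f t \<partial>lborel) \<noteq> \<infinity>"
    using pi_gt_zero by (auto simp: ennreal_mult_less_top ennreal_eq_0_iff simp del: pi_gt_zero)
  \<comment> \<open>Over the common denominator both densities contain the same term in
    \<open>u + d\<close>. What remains is \<open>exp (- \<mu> * \<bar>u - d\<bar>)\<close> against
    \<open>exp (\<mu> * (u - d))\<close>: equal for u \<le> d, strictly ordered for u > d.\<close>
  have val: "?q * (2 * sinh (\<mu> * u)) = (exp (\<mu> * (u - d)) - exp (- \<mu> * (u + d))) / (\<mu> * d)"
    "(- exp (- \<mu> * (u + d)) / \<mu> - - exp (- \<mu> * \<bar>u - d\<bar>) / \<mu>) / d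
      = (exp (- \<mu> * \<bar>u - d\<bar>) - exp (- \<mu> * (u + d))) / (\<mu> * d)" for u
  proof -
    have "exp (- \<mu> * d) * (2 * sinh (\<mu> * u)) = exp (\<mu> * (u - d)) - exp (- \<mu> * (u + d))"
      by (simp add: sinh_def algebra_simps exp_add[symmetric])
    then show "?q * (2 * sinh (\<mu> * u)) = (exp (\<mu> * (u - d)) - exp (- \<mu> * (u + d))) / (\<mu> * d)"
      by (simp add: d_def)
    show "(- exp (- \<mu> * (u + d)) / \<mu> - - exp (- \<mu> * \<bar>u - d\<bar>) / \<mu>) / d
      = (exp (- \<mu> * \<bar>u - d\<bar>) - exp (- \<mu> * (u + d))) / (\<mu> * d)"
      by (simp add: diff_divide_distrib)
  qed
  have g: "g t = indicator {0..r\<^sup>2} t * ennreal ((exp (\<mu> * (sqrt t - d)) - exp (- \<mu> * (sqrt t + d))) / (\<mu> * d))" for t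
  proof (cases "t \<ge> 0")
    case True
    then have "ennreal ?q * ennreal (2 * sinh (\<mu> * sqrt t)) = ennreal (?q * (2 * sinh (\<mu> * sqrt t)))"
      using \<mu> by (intro ennreal_mult[symmetric]) auto
    then show ?thesis
      unfolding val g_def using True by (auto split: split_indicator)
  qed (simp add: g_def)
  have f: "f t = indicator {0..r\<^sup>2} t * ennreal ((exp (- \<mu> * \<bar>sqrt t - d\<bar>) - exp (- \<mu> * (sqrt t + d))) / (\<mu> * d))" for t
    unfolding f_def val by (auto split: split_indicator)
  have "(\<integral>\<^sup>+t. f t \<partial>lborel) < (\<integral>\<^sup>+t. g t \<partial>lborel)"
  proof (rule nn_integral_less)
    have "exp (- \<mu> * \<bar>u - d\<bar>) \<le> exp (\<mu> * (u - d))" for u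
    proof -
      have "- (\<mu> * \<bar>u - d\<bar>) \<le> \<mu> * (u - d)"
        using \<mu> abs_ge_minus_self[of "\<mu> * (u - d)"] by (simp add: abs_mult)
      then show ?thesis by simp
    qed
    then have "f t \<le> g t" for t
      unfolding f g using \<mu> d by (intro mult_left_mono ennreal_leI divide_right_mono) auto
    then show "AE t in lborel. f t \<le> g t" by simp
    show "\<not> (AE t in lborel. g t \<le> f t)"
    proof
      assume "AE t in lborel. g t \<le> f t"
      \<comment> \<open>Strict inequality holds for the spheres that enclose \<open>z\<close> but
        stay inside the ball; their squared radii fill a nonempty open interval because
        \<open>z\<close> is strictly inside.\<close>
      then have "AE t in lborel. t \<notin> {d\<^sup>2<..<r\<^sup>2}"
      proof eventually_elim
        case (elim t)
        show ?case
        proof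
          assume t: "t \<in> {d\<^sup>2<..<r\<^sup>2}"
          then have t0: "t > 0" by (auto intro: le_less_trans[of _ "d\<^sup>2"])
          have "sqrt (d\<^sup>2) < sqrt t" using t by (simp only: real_sqrt_less_iff) simp
          then have u: "d < sqrt t" using d by simp
          let ?a = "exp (\<mu> * (sqrt t - d))" and ?b = "exp (- \<mu> * \<bar>sqrt t - d\<bar>)" and ?c = "exp (- \<mu> * (sqrt t + d))"
          have "- \<mu> * \<bar>sqrt t - d\<bar> < \<mu> * (sqrt t - d)"
            using u \<mu> by (auto intro: less_trans[of _ 0])
          then have "?b < ?a" by simp
          then have "(?b - ?c) / (\<mu> * d) < (?a - ?c) / (\<mu> * d)"
            using \<mu> d by (intro divide_strict_right_mono) auto
          \<comment> \<open>Nonnegativity of the smaller value ensures that the strict inequality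
            survives the passage to \<open>ennreal\<close>.\<close>
          moreover have "?c \<le> ?b"
            using \<mu> d u by simp
          then have "0 \<le> (?b - ?c) / (\<mu> * d)"
            using \<mu> d by simp
          ultimately have "f t < g t"
            unfolding f g using t t0 by (simp add: ennreal_less_iff)
          with elim show False by simp
        qed
      qed
      then have "{d\<^sup>2<..<r\<^sup>2} = {}"
        by (intro AE_notin_open_imp_empty) auto
      moreover have "d\<^sup>2 < r\<^sup>2" using d by (simp add: power_strict_mono)
      ultimately show False by simp
    qed
  qed (use fin in auto)
  with fg show False by simp
qed

section \<open>Comparison of \<open>D\<close> with the ball\<close>

lemma nn_integral_eq_set_integral:
  assumes "set_integrable M A f" "\<And>y. 0 \<le> f y"
  shows "(\<integral>\<^sup>+y. indicator A y * ennreal (f y) \<partial>M) = ennreal (LINT y:A|M. f y)"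
proof -
  have "(\<integral>\<^sup>+y. indicator A y * ennreal (f y) \<partial>M) = (\<integral>\<^sup>+y. ennreal (indicator A y *\<^sub>R f y) \<partial>M)"
    by (auto intro!: nn_integral_cong split: split_indicator)
  also have "\<dots> = ennreal (LINT y:A|M. f y)"
    using assms unfolding set_integrable_def set_lebesgue_integral_def
    by (intro nn_integral_eq_integral) auto
  finally show ?thesis .
qed

theorem theorem2:
  fixes \<mu> r :: real and D :: "(real^3) set" and x0 :: "real^3"
  assumes "\<mu> > 0"
    and "open D" and "connected D" and "bounded D"
    and "connected (- D)"
    and "r > 0" and "measure lborel (ball (0::real^3) r) = measure lborel D"
    and "x0 \<in> D"
    and "\<forall>x. x \<notin> D \<longrightarrow>
           a3_plus (\<mu> * r) * E_plus \<mu> x x0 = (LINT y:D|lborel. E_plus \<mu> y x) / measure lborel D"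
    and "\<forall>x. x \<notin> D \<longrightarrow>
           a3_plus (\<mu> * r) * E_minus \<mu> x x0 = (LINT y:D|lborel. E_minus \<mu> y x) / measure lborel D"
  shows "D = ball x0 r"
proof -
  note \<mu> = \<open>\<mu> > 0\<close> and r = \<open>r > 0\<close>
  \<comment> \<open>The closed ball has the same volume as the open one, and its complement is open,
    which makes \<open>D - C\<close> open later on.\<close>
  define C where "C = cball x0 r"
  define c where "c = a3_plus (\<mu> * r) * measure lborel D"
  have D: "D \<in> sets borel" using \<open>open D\<close> by simp
  have vol: "measure lborel D = measure lborel (ball x0 r)" "measure lborel D = measure lborel C"
    using assms(7) r by (simp_all add: C_def content_ball content_cball)
  then have V: "measure lborel D > 0" using r by simp
  have "a3_plus (\<mu> * r) > 0"
    using \<mu> r sinh_less_mult_cosh[of "\<mu> * r"] by (simp add: a3_plus_eq)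
  then have c: "c > 0" using V by (simp add: c_def)
  \<comment> \<open>Non-integrable functions have integral 0 by convention, so integrability must be
    settled before the two identities may be subtracted.\<close>
  have int: "set_integrable lborel A (\<lambda>y. exp (\<mu> * dist y x) / dist y x)"
      "set_integrable lborel A (\<lambda>y. exp (- \<mu> * dist y x) / dist y x)"
      "set_integrable lborel A (\<lambda>y. sinh (\<mu> * dist y x) / dist y x)"
    if "bounded A" "A \<in> sets borel" for A and x :: "real^3"
    by (intro set_integrable_radial_kernel[OF that, where k="\<lambda>u. exp (\<mu> * u)"]
        set_integrable_radial_kernel[OF that, where k="\<lambda>u. exp (- \<mu> * u)"]
        set_integrable_radial_kernel[OF that, where k="\<lambda>u. sinh (\<mu> * u)"] continuous_intros)+
  note intD = int[OF \<open>bounded D\<close> D]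
  have C: "bounded C" "C \<in> sets borel" by (simp_all add: C_def)
  have indC: "indicator {..r\<^sup>2} ((dist y x0)\<^sup>2) = (indicator C y :: ennreal)" for y
  proof -
    have "(dist y x0)\<^sup>2 \<le> r\<^sup>2 \<longleftrightarrow> dist y x0 \<le> r"
      using r by (simp add: abs_le_square_iff[symmetric])
    then show ?thesis by (simp add: C_def indicator_def dist_commute)
  qed
  have plus: "(LINT y:D|lborel. exp (\<mu> * dist y x) / dist y x) = c * (exp (\<mu> * dist x x0) / dist x x0)"
    and minus: "(LINT y:D|lborel. exp (- \<mu> * dist y x) / dist y x) = c * (exp (- \<mu> * dist x x0) / dist x x0)"
    if "x \<notin> D" for x
    using assms(9,10)[rule_format, OF that] V by (simp_all add: E_plus_def E_minus_def c_def field_simps)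
  have sinh: "(LINT y:D|lborel. sinh (\<mu> * dist y x) / dist y x) = c * (sinh (\<mu> * dist x x0) / dist x x0)"
    if "x \<notin> D" for x
  proof -
    have *: "sinh (\<mu> * u) / u = (exp (\<mu> * u) / u - exp (- \<mu> * u) / u) / 2" for u
      by (simp add: sinh_def diff_divide_distrib)
    show ?thesis
      unfolding * using intD plus[OF that] minus[OF that] by (simp add: algebra_simps)
  qed
  have "(\<integral>\<^sup>+y. indicator D y * ennreal (sinh (\<mu> * dist y x0) / (\<mu> * dist y x0)) \<partial>lborel) = ennreal c"
  proof (rule sinh_potential_center[OF \<mu> \<open>open D\<close> \<open>bounded D\<close>])
    fix x assume "x \<notin> D"
    then have "(\<integral>\<^sup>+y. indicator D y * ennreal (sinh (\<mu> * dist y x) / dist y x) \<partial>lborel)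
        = ennreal (c * (sinh (\<mu> * dist x x0) / dist x x0))"
      using \<mu> intD(3) by (subst nn_integral_eq_set_integral) (auto simp: sinh)
    then show "(\<integral>\<^sup>+y. indicator D y * ennreal (sinh (\<mu> * dist x y) / dist x y) \<partial>lborel)
        = ennreal c * ennreal (sinh (\<mu> * dist x x0) / dist x x0)"
      using c \<mu> by (subst ennreal_mult[symmetric]) (simp_all add: dist_commute)
  qed (use c in simp)
  moreover have "(\<integral>\<^sup>+y. indicator D y * ennreal (sinh (\<mu> * dist y x0) / (\<mu> * dist y x0)) \<partial>lborel)
      = ennreal (LINT y:D|lborel. sinh (\<mu> * dist y x0) / (\<mu> * dist y x0))"
    using set_integrable_divide[OF intD(3)[of x0], of \<mu>] \<mu>
    by (intro nn_integral_eq_set_integral) (auto simp: mult_ac)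
  \<comment> \<open>Equal images under \<open>ennreal\<close> determine the reals only once negative
    values are excluded.\<close>
  moreover have nnD: "(LINT y:A|lborel. sinh (\<mu> * dist y x0) / (\<mu> * dist y x0)) \<ge> 0"
    "(LINT y:A|lborel. sinh (\<mu> * dist y x0) / dist y x0) \<ge> 0" for A
    using \<mu> by (auto simp: set_lebesgue_integral_def intro!: integral_nonneg_AE)
  ultimately have "(LINT y:D|lborel. sinh (\<mu> * dist y x0) / (\<mu> * dist y x0)) = c"
    using c by simp
  moreover have "(LINT y:D|lborel. sinh (\<mu> * dist y x0) / (\<mu> * dist y x0))
      = (LINT y:D|lborel. sinh (\<mu> * dist y x0) / dist y x0) / \<mu>"
    by (subst set_integral_divide_zero[symmetric]) (simp add: mult_ac)
  ultimately have D_center: "(LINT y:D|lborel. sinh (\<mu> * dist y x0) / dist y x0) = c * \<mu>"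
    using \<mu> by (simp add: field_simps)
  have S: "(\<integral>\<^sup>+y. indicator C y * ennreal (sinh (\<mu> * dist y x0) / dist y x0) \<partial>lborel) = ennreal (c * \<mu>)"
    using nn_integral_sinh_kernel_cball[OF \<mu> r, of x0] vol by (simp add: indC c_def)
  then have "ennreal (LINT y:C|lborel. sinh (\<mu> * dist y x0) / dist y x0) = ennreal (c * \<mu>)"
    using \<mu> int(3)[OF C] by (subst (asm) nn_integral_eq_set_integral) auto
  then have C_center: "(LINT y:C|lborel. sinh (\<mu> * dist y x0) / dist y x0) = c * \<mu>"
    using c \<mu> nnD(2)[of C] by simp
  have AE: "AE y in lborel. y \<in> D \<longleftrightarrow> y \<in> C"
    unfolding C_def
  \<comment> \<open>Division by zero gives this kernel the value 0 at the centre instead of its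
    limit \<mu>; monotonicity is asked for only at positive distances.\<close>
  proof (rule AE_eq_cball_if_radial_integral_eq[where f="\<lambda>u. sinh (\<mu> * u) / u"])
    show "emeasure lborel D < \<infinity>"
      by (rule emeasure_bounded_finite[OF \<open>bounded D\<close>])
  qed (use \<mu> r D \<open>x0 \<in> D\<close> vol intD(3) int(3)[OF C] D_center C_center in
      \<open>simp_all add: C_def sinh_mult_divide_strict_mono\<close>)
  have sub: "D \<subseteq> ball x0 r"
  proof -
    have "AE y in lborel. y \<notin> D - C" using AE by eventually_elim auto
    then have "D - C = {}"
      using \<open>open D\<close> by (intro AE_notin_open_imp_empty open_Diff) (simp_all add: C_def)
    then have "D \<subseteq> interior C"
      using \<open>open D\<close> by (intro interior_maximal) auto
    then show ?thesis by (simp add: C_def)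
  qed
  have "x \<in> D" if x: "x \<in> ball x0 r" for x
  proof (rule ccontr)
    assume nx: "x \<notin> D"
    then have neq: "x \<noteq> x0" using \<open>x0 \<in> D\<close> by auto
    \<comment> \<open>The decaying identity at \<open>x\<close>, available because \<open>x\<close>
      is assumed outside \<open>D\<close>, carries over to \<open>C\<close> since the two sets
      differ by a null set.\<close>
    have "(LINT y:C|lborel. exp (- \<mu> * dist y x) / dist y x) = c * (exp (- \<mu> * dist x x0) / dist x x0)"
      using set_integral_cong_set[OF _ _ AE, of "\<lambda>y. exp (- \<mu> * dist y x) / dist y x"] intD(2)[of x] int(2)[OF C, of x] minus[OF nx]
      by (simp add: set_borel_measurable_def set_integrable_def)
    then have "(\<integral>\<^sup>+y. indicator C y * ennreal (exp (- \<mu> * dist y x) / dist y x) \<partial>lborel)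
        = ennreal (c * (exp (- \<mu> * dist x x0) / dist x x0))"
      using int(2)[OF C, of x] by (subst nn_integral_eq_set_integral) auto
    \<comment> \<open>The constant is regrouped so that \<open>c * \<mu>\<close> appears, which
      \<open>S\<close> identifies with the integral of the hyperbolic sine kernel over the
      ball.\<close>
    also have "\<dots> = ennreal (exp (- \<mu> * dist x x0) / (\<mu> * dist x x0)) * ennreal (c * \<mu>)"
      using \<mu> c by (subst ennreal_mult[symmetric]) auto
    finally show False
      using nn_integral_yukawa_kernel_cball_neq[OF \<mu> neq, of r] x
      unfolding indC S by (simp add: dist_commute)
  qed
  with sub show ?thesis by blast
qed

end
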